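(* Let $R$ be a commutative ring with identity $1 \neq 0$. Then the polynomial ring $R[x]$ is a weak von Neumann regular ring if and only if $R$ has exactly two idempotent elements.
   Context: All rings are commutative with identity $1\neq 0$. A ring $S$ is called a weak von Neumann regular ring (WVNR ring) if for all finitely generated ideals $I$ and $J$ of $S$ with $I \subseteq J \subsetneq S$: whenever $J$ is generated by an idempotent element of $S$, then $I$ is also generated by an idempotent element of $S$. *)

theory Defs
  imports "HOL-Algebra.UnivPoly"
begin

definition idempotents :: "('a, 'm) ring_scheme \<Rightarrow> 'a set"
  where "idempotents S = {e \<in> carrier S. e \<otimes>\<^bsub>S\<^esub> e = e}"

definition fin_gen_ideal :: "'a set \<Rightarrow> ('a, 'm) ring_scheme \<Rightarrow> bool"
  where "fin_gen_ideal I S \<longleftrightarrow> (\<exists>A \<subseteq> carrier S. finite A \<and> I = Idl\<^bsub>S\<^esub> A)"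

definition idem_gen_ideal :: "'a set \<Rightarrow> ('a, 'm) ring_scheme \<Rightarrow> bool"
  where "idem_gen_ideal I S \<longleftrightarrow> (\<exists>e \<in> idempotents S. I = Idl\<^bsub>S\<^esub> {e})"

(* cring admits the zero ring, hence the separate assumption one_not_zero. *)
locale wvnr_ring = cring S for S (structure) +
  assumes one_not_zero: "\<one> \<noteq> \<zero>"
    and idem_gen_inherited:
      "\<lbrakk> fin_gen_ideal I S; fin_gen_ideal J S; I \<subseteq> J; J \<subset> carrier S; idem_gen_ideal J S \<rbrakk>
        \<Longrightarrow> idem_gen_ideal I S"

end

theory Submission
  imports Defs
begin

text \<open>An idempotent \<open>f\<close> of \<open>R[x]\<close> with constant coefficient \<open>0\<close> vanishes, since comparing
  coefficients in \<open>f\<^sup>2 = f\<close> expresses the \<open>n\<close>-th coefficient through products of lower ones. Hence if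
  \<open>R\<close> has only trivial idempotents, so does \<open>R[x]\<close>, and the only proper ideal generated by an
  idempotent is \<open>0\<close>. Conversely, if \<open>e \<noteq> 0, 1\<close> is an idempotent of \<open>R\<close>, then \<open>(e x) \<subseteq> (e) \<noteq> R[x]\<close>,
  but every element of \<open>(e x)\<close> has constant coefficient \<open>0\<close>, so an idempotent generator of
  \<open>(e x)\<close> would be \<open>0\<close>.\<close>

lemma fin_gen_ideal_singleton:
  "a \<in> carrier S \<Longrightarrow> fin_gen_ideal (Idl\<^bsub>S\<^esub> {a}) S"
  unfolding fin_gen_ideal_def by blast

context cring
begin

lemma zero_in_idempotents: "\<zero> \<in> idempotents R"
  by (simp add: idempotents_def)

lemma one_in_idempotents: "\<one> \<in> idempotents R"
  by (simp add: idempotents_def)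

text \<open>Passing to the complement turns an idempotent with constant coefficient
  \<open>\<one>\<close> into one with constant coefficient \<open>\<zero>\<close>.\<close>

lemma one_minus_in_idempotents:
  assumes "e \<in> idempotents R"
  shows "\<one> \<ominus> e \<in> idempotents R"
proof -
  have e: "e \<in> carrier R" "e \<otimes> e = e"
    using assms by (auto simp: idempotents_def)
  have "(\<one> \<ominus> e) \<otimes> (\<one> \<ominus> e) = \<one> \<ominus> e \<ominus> e \<oplus> e \<otimes> e"
    using e(1) by algebra
  also have "\<dots> = \<one> \<ominus> e"
    unfolding e(2) using e(1) by algebra
  finally show ?thesis
    using e(1) by (simp add: idempotents_def)
qed

text \<open>Multiplying \<open>q \<otimes> e = \<one>\<close> by \<open>e\<close> leaves its left
  side unchanged. This makes the ideal generated by an idempotent other than \<open>\<one>\<close>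
  proper.\<close>

lemma idempotent_unit_eq_one:
  assumes "e \<in> idempotents R" and "q \<in> carrier R" and "q \<otimes> e = \<one>"
  shows "e = \<one>"
proof -
  have e: "e \<in> carrier R" "e \<otimes> e = e"
    using assms(1) by (auto simp: idempotents_def)
  have "e = (q \<otimes> e) \<otimes> e"
    using assms(3) e(1) by simp
  also have "\<dots> = q \<otimes> e"
    using assms(2) e by (simp add: m_assoc)
  finally show ?thesis
    using assms(3) by simp
qed

text \<open>Turns membership in a principal ideal into an equation whose coefficients can be
  compared.\<close>

lemma mem_genideal_singleton_iff:
  assumes "a \<in> carrier R"
  shows "b \<in> Idl {a} \<longleftrightarrow> (\<exists>q \<in> carrier R. b = q \<otimes> a)"
  using assms by (auto simp: cgenideal_eq_genideal[symmetric] cgenideal_def)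

lemma card_idempotents_eq_2_iff:
  assumes "\<one> \<noteq> \<zero>"
  shows "card (idempotents R) = 2 \<longleftrightarrow> idempotents R = {\<zero>, \<one>}"
proof
  assume "card (idempotents R) = 2"
  then show "idempotents R = {\<zero>, \<one>}"
    using zero_in_idempotents one_in_idempotents assms by (auto simp: card_2_iff)
qed (use assms in auto)

end

lemma (in UP_cring) idempotent_coeff_0_eq_zero:
  assumes "f \<in> idempotents P" and "coeff P f 0 = \<zero>"
  shows "f = \<zero>\<^bsub>P\<^esub>"
proof -
  have f: "f \<in> carrier P" "f \<otimes>\<^bsub>P\<^esub> f = f"
    using assms(1) by (auto simp: idempotents_def)
  have "coeff P f n = \<zero>" for n
  proof (induction n rule: less_induct)
    case (less n)
    \<comment> \<open>Each term of the convolution has a vanishing factor: the left one by induction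
      if \<open>i < n\<close>, the right one, the constant coefficient, if \<open>i = n\<close>. The
      latter also covers \<open>n = 0\<close>.\<close>
    have "coeff P f i \<otimes> coeff P f (n - i) = \<zero>" if "i \<le> n" for i
    proof (cases "i < n")
      case True
      then show ?thesis
        using less.IH f(1) by simp
    next
      case False
      then show ?thesis
        using that assms(2) f(1) by simp
    qed
    then have "(\<Oplus>i \<in> {..n}. coeff P f i \<otimes> coeff P f (n - i)) = (\<Oplus>i \<in> {..n}. \<zero>)"
      by (intro R.finsum_cong') auto
    then have "coeff P (f \<otimes>\<^bsub>P\<^esub> f) n = \<zero>"
      using f(1) by (simp add: coeff_mult del: R.finsum_zero) (simp add: R.finsum_zero)
    then show ?case
      using f(2) by simp
  qed
  then show ?thesis
    using f(1) by (intro up_eqI) auto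
qed

lemma (in UP_cring) coeff_0_mult:
  assumes "p \<in> carrier P" "q \<in> carrier P"
  shows "coeff P (p \<otimes>\<^bsub>P\<^esub> q) 0 = coeff P p 0 \<otimes> coeff P q 0"
  using assms by (simp add: coeff_mult)

text \<open>Taking constant coefficients is multiplicative, so the constant coefficient of
  \<open>f\<close> is \<open>\<zero>\<close> or \<open>\<one>\<close>; then \<open>f\<close> or its
  complement vanishes.\<close>

lemma (in UP_cring) idempotents_UP_trivial:
  assumes "idempotents R = {\<zero>, \<one>}"
  shows "idempotents P \<subseteq> {\<zero>\<^bsub>P\<^esub>, \<one>\<^bsub>P\<^esub>}"
proof
  fix f assume f: "f \<in> idempotents P"
  then have fc: "f \<in> carrier P" "f \<otimes>\<^bsub>P\<^esub> f = f"
    by (auto simp: idempotents_def)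
  have "coeff P f 0 \<in> idempotents R"
    using coeff_0_mult[of f f] fc by (simp add: idempotents_def)
  then consider "coeff P f 0 = \<zero>" | "coeff P f 0 = \<one>"
    using assms by auto
  then show "f \<in> {\<zero>\<^bsub>P\<^esub>, \<one>\<^bsub>P\<^esub>}"
  proof cases
    case 1
    then show ?thesis
      using idempotent_coeff_0_eq_zero[OF f] by simp
  next
    case 2
    then have "coeff P (\<one>\<^bsub>P\<^esub> \<ominus>\<^bsub>P\<^esub> f) 0 = \<zero>"
      using fc(1) by (simp add: a_minus_def R.r_neg)
    then have "\<one>\<^bsub>P\<^esub> \<ominus>\<^bsub>P\<^esub> f = \<zero>\<^bsub>P\<^esub>"
      using idempotent_coeff_0_eq_zero P.one_minus_in_idempotents[OF f] by blast
    then show ?thesis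
      using fc(1) P.minus_equality[of "\<one>\<^bsub>P\<^esub>" "\<ominus>\<^bsub>P\<^esub> f"] by (simp add: a_minus_def)
  qed
qed

lemma (in UP_cring) wvnr_UP_if_trivial_idempotents:
  assumes "\<one> \<noteq> \<zero>" and "idempotents R = {\<zero>, \<one>}"
  shows "wvnr_ring P"
proof unfold_locales
  have "coeff P \<one>\<^bsub>P\<^esub> 0 \<noteq> coeff P \<zero>\<^bsub>P\<^esub> 0"
    using assms(1) by simp
  then show "\<one>\<^bsub>P\<^esub> \<noteq> \<zero>\<^bsub>P\<^esub>"
    by metis
next
  fix I J
  assume "fin_gen_ideal I P" "I \<subseteq> J" "J \<subset> carrier P" "idem_gen_ideal J P"
  then obtain e A where e: "e \<in> idempotents P" "J = Idl\<^bsub>P\<^esub> {e}"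
    and A: "A \<subseteq> carrier P" "I = Idl\<^bsub>P\<^esub> A"
    by (auto simp: idem_gen_ideal_def fin_gen_ideal_def)
  \<comment> \<open>Otherwise \<open>J\<close> would be the whole ring.\<close>
  have "e \<noteq> \<one>\<^bsub>P\<^esub>"
    using P.genideal_one e(2) \<open>J \<subset> carrier P\<close> by auto
  then have "e = \<zero>\<^bsub>P\<^esub>"
    using idempotents_UP_trivial[OF assms(2)] e(1) by auto
  then have "I \<subseteq> {\<zero>\<^bsub>P\<^esub>}"
    using \<open>I \<subseteq> J\<close> e(2) P.genideal_zero by simp
  moreover have "\<zero>\<^bsub>P\<^esub> \<in> I"
    using P.genideal_ideal[OF A(1)] A(2)
    by (simp add: additive_subgroup.zero_closed ideal.axioms(1))
  ultimately have "I = {\<zero>\<^bsub>P\<^esub>}"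
    by blast
  then have "I = Idl\<^bsub>P\<^esub> {\<zero>\<^bsub>P\<^esub>}"
    using P.genideal_zero by simp
  then show "idem_gen_ideal I P"
    unfolding idem_gen_ideal_def using P.zero_in_idempotents by blast
qed

lemma (in UP_cring) trivial_idempotents_if_wvnr_UP:
  assumes "wvnr_ring P"
  shows "idempotents R \<subseteq> {\<zero>, \<one>}"
proof
  fix e assume e: "e \<in> idempotents R"
  then have ec: "e \<in> carrier R" "e \<otimes> e = e"
    by (auto simp: idempotents_def)
  interpret W: wvnr_ring P by (rule assms)
  \<comment> \<open>The constant \<open>e\<close> and the polynomial \<open>e x\<close>. The factor
    \<open>e\<close> puts \<open>e x\<close> into the ideal of \<open>e\<close>; the factor
    \<open>x\<close> removes the constant coefficient.\<close>
  let ?c = "monom P e 0" and ?m = "monom P e 1"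
  let ?I = "Idl\<^bsub>P\<^esub> {?m}" and ?J = "Idl\<^bsub>P\<^esub> {?c}"
  show "e \<in> {\<zero>, \<one>}"
  proof (rule ccontr)
    assume "e \<notin> {\<zero>, \<one>}"
    have mem_I: "f \<in> ?I \<longleftrightarrow> (\<exists>q \<in> carrier P. f = q \<otimes>\<^bsub>P\<^esub> ?m)"
      and mem_J: "f \<in> ?J \<longleftrightarrow> (\<exists>q \<in> carrier P. f = q \<otimes>\<^bsub>P\<^esub> ?c)" for f
      using ec(1) by (auto simp: P.mem_genideal_singleton_iff)
    have "?m = monom P \<one> 1 \<otimes>\<^bsub>P\<^esub> ?c"
      using ec(1) monom_mult[of \<one> e 1 0] by simp
    then have "?m \<in> ?J"
      using mem_J by auto
    then have "?I \<subseteq> ?J"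
      using ec(1) by (intro P.genideal_minimal P.genideal_ideal) auto
    moreover have "?J \<subset> carrier P"
    proof -
      have "\<one>\<^bsub>P\<^esub> \<notin> ?J"
      proof
        assume "\<one>\<^bsub>P\<^esub> \<in> ?J"
        then obtain q where q: "q \<in> carrier P" "\<one>\<^bsub>P\<^esub> = q \<otimes>\<^bsub>P\<^esub> ?c"
          using mem_J by blast
        \<comment> \<open>Constant coefficients of \<open>1 = q e\<close> make \<open>e\<close> a
          unit of \<open>R\<close>.\<close>
        then have "coeff P q 0 \<otimes> e = \<one>"
          using coeff_0_mult[of q ?c] ec(1) by (simp flip: q(2))
        then show False
          using R.idempotent_unit_eq_one[OF e, of "coeff P q 0"] q(1) \<open>e \<notin> {\<zero>, \<one>}\<close> by simp
      qed
      moreover have "?J \<subseteq> carrier P"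
        using mem_J ec(1) by auto
      ultimately show ?thesis
        by blast
    qed
    moreover have "?c \<in> idempotents P"
      using ec monom_mult[of e e 0 0] by (simp add: idempotents_def)
    then have "idem_gen_ideal ?J P"
      unfolding idem_gen_ideal_def by blast
    ultimately have "idem_gen_ideal ?I P"
      using ec(1) by (intro W.idem_gen_inherited[of ?I ?J] fin_gen_ideal_singleton) auto
    then obtain f where f: "f \<in> idempotents P" "?I = Idl\<^bsub>P\<^esub> {f}"
      unfolding idem_gen_ideal_def by blast
    have "f \<in> ?I"
      unfolding f(2) using f(1) by (intro P.genideal_self') (simp add: idempotents_def)
    then obtain q where "q \<in> carrier P" "f = q \<otimes>\<^bsub>P\<^esub> ?m"
      using mem_I by blast
    then have "coeff P f 0 = \<zero>"
      using coeff_0_mult[of q ?m] ec(1) by simp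
    then have "?I = {\<zero>\<^bsub>P\<^esub>}"
      using idempotent_coeff_0_eq_zero[OF f(1)] f(2) P.genideal_zero by simp
    then have "?m = \<zero>\<^bsub>P\<^esub>"
      using P.genideal_self'[of ?m] ec(1) by simp
    \<comment> \<open>This coefficient of \<open>e x\<close> is \<open>e\<close>, which was assumed
      nonzero.\<close>
    then have "coeff P ?m 1 = \<zero>"
      by simp
    then show False
      using ec(1) \<open>e \<notin> {\<zero>, \<one>}\<close> by simp
  qed
qed

theorem theorem2p14:
  fixes R (structure)
  assumes "cring R"
    and "\<one> \<noteq> \<zero>"
  shows "wvnr_ring (UP R) \<longleftrightarrow> card (idempotents R) = 2"
proof -
  interpret UP_cring R "UP R"
    by (simp add: UP_cring_def assms(1))
  \<comment> \<open>Both trivial idempotents always exist, so the inclusion proved from the WVNR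
    property is already an equality.\<close>
  have "idempotents R = {\<zero>, \<one>} \<longleftrightarrow> idempotents R \<subseteq> {\<zero>, \<one>}"
    using R.zero_in_idempotents R.one_in_idempotents by blast
  then show ?thesis
    using wvnr_UP_if_trivial_idempotents[OF assms(2)] trivial_idempotents_if_wvnr_UP
      R.card_idempotents_eq_2_iff[OF assms(2)] by blast
qed

end
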